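(* Every countable lattice has the selection property for convex sublattices (CLSP).
   Context: For a lattice $T$, $\mathcal{C}_L(T)$ is the set of nonempty convex sublattices of $T$ ordered by the bi-dominating order: $X\le Y$ iff every element of $X$ is below some element of $Y$ and every element of $Y$ is above some element of $X$. $T$ has CLSP if there is an order preserving map $\varphi:\mathcal{C}_L(T)\to T$ with $\varphi(S)\in S$ for all $S\in\mathcal{C}_L(T)$. *)

theory Defs
  imports "HOL-Library.Countable_Set"
begin

definition convex_sublattice :: "'a::lattice set \<Rightarrow> bool" where
  "convex_sublattice X \<longleftrightarrow>
     (\<forall>x\<in>X. \<forall>y\<in>X. inf x y \<in> X \<and> sup x y \<in> X) \<and>
     (\<forall>x\<in>X. \<forall>y\<in>X. \<forall>z. x \<le> z \<and> z \<le> y \<longrightarrow> z \<in> X)"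

definition nonempty_convex_sublattices :: "'a::lattice set set" where
  "nonempty_convex_sublattices = {X. X \<noteq> {} \<and> convex_sublattice X}"

definition bidom_le :: "'a::lattice set \<Rightarrow> 'a set \<Rightarrow> bool" where
  "bidom_le X Y \<longleftrightarrow> (\<forall>x\<in>X. \<exists>y\<in>Y. x \<le> y) \<and> (\<forall>y\<in>Y. \<exists>x\<in>X. x \<le> y)"

text \<open>The lattice is the whole type \<open>'a\<close>. The map is a total function on \<open>'a set\<close>
  whose values outside \<^const>\<open>nonempty_convex_sublattices\<close> are irrelevant.\<close>

definition CLSP :: "'a::lattice itself \<Rightarrow> bool" where
  "CLSP (T :: 'a itself) \<longleftrightarrow>
     (\<exists>\<phi> :: 'a set \<Rightarrow> 'a.
        monotone_on nonempty_convex_sublattices bidom_le (\<le>) \<phi> \<and>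
        (\<forall>S\<in>nonempty_convex_sublattices. \<phi> S \<in> S))"

end

(* Idea: for an enumeration t of the lattice we build monotone maps x_0, x_1, ... on sets, each
   with finite range, such that x_n S lies in S as soon as t_i lies in S for some i < n, and
   x_{n+1} S = x_n S once x_n S lies in S. The eventual value of x_n S is then the required
   selection. To pass from x_n to x_{n+1}, let P be the finite set consisting of t_n and all
   values of x_n. Meet x_n S with the join of those elements of P that lie in the ideal
   generated by S, then apply the dual step. Finiteness of P makes the join exist; having all
   values of x_n in P makes the meet leave x_n S unchanged if it is already in the ideal. *)
theory Submission
  imports Defs
begin

definition down_closure :: "'a::lattice set \<Rightarrow> 'a set" where
  "down_closure S = {x. \<exists>s\<in>S. x \<le> s}"

definition up_closure :: "'a::lattice set \<Rightarrow> 'a set" where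
  "up_closure S = {x. \<exists>s\<in>S. s \<le> x}"

text \<open>Splits the order into growth of the generated ideal and shrinking of the generated
  filter, so each half step has to react to one inclusion only.\<close>

lemma bidom_le_iff_closures:
  "bidom_le X Y \<longleftrightarrow> down_closure X \<subseteq> down_closure Y \<and> up_closure Y \<subseteq> up_closure X"
proof -
  have "down_closure X \<subseteq> down_closure Y \<longleftrightarrow> (\<forall>x\<in>X. \<exists>y\<in>Y. x \<le> y)"
    unfolding down_closure_def subset_iff mem_Collect_eq by (meson order_refl order_trans)
  moreover have "up_closure Y \<subseteq> up_closure X \<longleftrightarrow> (\<forall>y\<in>Y. \<exists>x\<in>X. x \<le> y)"
    unfolding up_closure_def subset_iff mem_Collect_eq by (meson order_refl order_trans)
  ultimately show ?thesis
    by (simp add: bidom_le_def)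
qed

lemma in_closures_if_mem:
  assumes "x \<in> S"
  shows "x \<in> down_closure S" and "x \<in> up_closure S"
  using assms by (auto simp: down_closure_def up_closure_def)

text \<open>Convexity gives the nontrivial direction: an element between two members of
  \<open>S\<close> is itself in \<open>S\<close>.\<close>

lemma mem_iff_closures:
  assumes "convex_sublattice S"
  shows "x \<in> S \<longleftrightarrow> x \<in> down_closure S \<and> x \<in> up_closure S"
  using assms unfolding convex_sublattice_def down_closure_def up_closure_def mem_Collect_eq
  by (meson order_refl)

lemma down_closure_antimono_mem: "y \<in> down_closure S \<Longrightarrow> x \<le> y \<Longrightarrow> x \<in> down_closure S"
  unfolding down_closure_def by (auto intro: order_trans)

lemma up_closure_mono_mem: "y \<in> up_closure S \<Longrightarrow> y \<le> x \<Longrightarrow> x \<in> up_closure S"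
  unfolding up_closure_def by (auto intro: order_trans)

lemma Sup_fin_in_down_closure:
  assumes "finite A" "A \<noteq> {}" "A \<subseteq> down_closure S" "convex_sublattice S"
  shows "Sup_fin A \<in> down_closure S"
  using assms
proof (induction A rule: finite_ne_induct)
  case (insert a A)
  then obtain s u where "s \<in> S" "a \<le> s" "u \<in> S" "Sup_fin A \<le> u"
    by (auto simp: down_closure_def)
  moreover from this have "sup s u \<in> S"
    using insert.prems unfolding convex_sublattice_def by blast
  ultimately show ?case
    using insert.hyps unfolding down_closure_def
    by (auto intro!: bexI[of _ "sup s u"] intro: le_supI1 le_supI2)
qed simp

lemma Inf_fin_in_up_closure:
  assumes "finite A" "A \<noteq> {}" "A \<subseteq> up_closure S" "convex_sublattice S"
  shows "Inf_fin A \<in> up_closure S"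
  using assms
proof (induction A rule: finite_ne_induct)
  case (insert a A)
  then obtain s u where "s \<in> S" "s \<le> a" "u \<in> S" "u \<le> Inf_fin A"
    by (auto simp: up_closure_def)
  moreover from this have "inf s u \<in> S"
    using insert.prems unfolding convex_sublattice_def by blast
  ultimately show ?case
    using insert.hyps unfolding up_closure_def
    by (auto intro!: bexI[of _ "inf s u"] intro: le_infI1 le_infI2)
qed simp

(* Adjoining the lower bound Inf_fin P keeps the join meaningful and monotone in S when P does
   not meet the ideal generated by S; otherwise it does not change the join. *)
definition lower_step :: "'a::lattice \<Rightarrow> ('a set \<Rightarrow> 'a) \<Rightarrow> 'a set \<Rightarrow> 'a" where
  "lower_step t f S = (let P = insert t (range f) in
     inf (f S) (Sup_fin (insert (Inf_fin P) (P \<inter> down_closure S))))"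

definition upper_step :: "'a::lattice \<Rightarrow> ('a set \<Rightarrow> 'a) \<Rightarrow> 'a set \<Rightarrow> 'a" where
  "upper_step t f S = (let P = insert t (range f) in
     sup (f S) (Inf_fin (insert (Sup_fin P) (P \<inter> up_closure S))))"

text \<open>The value depends only on \<open>f S\<close> and on the subset of \<open>P\<close> cut
  out by the ideal, which leaves finitely many pairs.\<close>

lemma finite_range_lower_step:
  assumes "finite (range f)"
  shows "finite (range (lower_step t f))"
proof -
  define P where "P = insert t (range f)"
  have "range (lower_step t f) \<subseteq>
      (\<lambda>(x, A). inf x (Sup_fin (insert (Inf_fin P) A))) ` (P \<times> Pow P)"
    by (auto simp: lower_step_def P_def Let_def image_iff)
  moreover have "finite P"
    using assms by (simp add: P_def)
  ultimately show ?thesis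
    by (meson finite_Pow_iff finite_SigmaI finite_imageI finite_subset)
qed

lemma finite_range_upper_step:
  assumes "finite (range f)"
  shows "finite (range (upper_step t f))"
proof -
  define P where "P = insert t (range f)"
  have "range (upper_step t f) \<subseteq>
      (\<lambda>(x, A). sup x (Inf_fin (insert (Sup_fin P) A))) ` (P \<times> Pow P)"
    by (auto simp: upper_step_def P_def Let_def image_iff)
  moreover have "finite P"
    using assms by (simp add: P_def)
  ultimately show ?thesis
    by (meson finite_Pow_iff finite_SigmaI finite_imageI finite_subset)
qed

text \<open>\<open>P\<close> is the same for \<open>X\<close> and \<open>Y\<close>, and the larger
  ideal of \<open>Y\<close> only adds elements to the join.\<close>

lemma lower_step_mono:
  assumes "finite (range f)" "f X \<le> f Y" "bidom_le X Y"
  shows "lower_step t f X \<le> lower_step t f Y"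
  unfolding lower_step_def Let_def
  using assms by (intro inf_mono Sup_fin.subset_imp) (auto simp: bidom_le_iff_closures)

text \<open>The filter of \<open>Y\<close> is the smaller one, so its meet runs over fewer elements
  of \<open>P\<close> and can only increase.\<close>

lemma upper_step_mono:
  assumes "finite (range f)" "f X \<le> f Y" "bidom_le X Y"
  shows "upper_step t f X \<le> upper_step t f Y"
  unfolding upper_step_def Let_def
  using assms by (intro sup_mono Inf_fin.subset_imp) (auto simp: bidom_le_iff_closures)

lemma lower_step_eq:
  assumes "finite (range f)" "f S \<in> S"
  shows "lower_step t f S = f S"
  unfolding lower_step_def Let_def
  using assms by (intro inf_absorb1 Sup_fin.coboundedI) (auto simp: in_closures_if_mem)

lemma upper_step_eq:
  assumes "finite (range f)" "f S \<in> S"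
  shows "upper_step t f S = f S"
  unfolding upper_step_def Let_def
  using assms by (intro sup_absorb1 Inf_fin.coboundedI) (auto simp: in_closures_if_mem)

lemma lower_step_in_down_closure:
  assumes "finite (range f)" "convex_sublattice S" "t \<in> S"
  shows "lower_step t f S \<in> down_closure S"
proof -
  define P where "P = insert t (range f)"
  have fin: "finite P"
    using assms by (simp add: P_def)
  \<comment> \<open>The adjoined bound is harmless here: it lies below \<open>t\<close>, which is in
    \<open>S\<close>.\<close>
  have "Inf_fin P \<in> down_closure S"
    using fin assms(3) by (auto simp: P_def down_closure_def intro!: bexI[of _ t] Inf_fin.coboundedI)
  then have "Sup_fin (insert (Inf_fin P) (P \<inter> down_closure S)) \<in> down_closure S"
    using fin assms(2) by (intro Sup_fin_in_down_closure) auto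
  then show ?thesis
    by (auto simp: lower_step_def Let_def P_def intro: down_closure_antimono_mem)
qed

text \<open>Joining with \<open>m\<close> enters the filter; the ideal is not left, because
  \<open>t\<close> is among the elements met and so \<open>m\<close> stays below
  \<open>t\<close>.\<close>

lemma upper_step_mem:
  assumes "finite (range f)" "convex_sublattice S" "t \<in> S" "f S \<in> down_closure S"
  shows "upper_step t f S \<in> S"
proof -
  define P where "P = insert t (range f)"
  define m where "m = Inf_fin (insert (Sup_fin P) (P \<inter> up_closure S))"
  have fin: "finite P"
    using assms by (simp add: P_def)
  have "Sup_fin P \<in> up_closure S"
    using fin assms(3) by (auto simp: P_def up_closure_def intro!: bexI[of _ t] Sup_fin.coboundedI)
  then have "m \<in> up_closure S"
    unfolding m_def using fin assms(2) by (intro Inf_fin_in_up_closure) auto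
  then have up: "sup (f S) m \<in> up_closure S"
    by (rule up_closure_mono_mem) simp
  have "m \<le> t"
    unfolding m_def using fin assms(3)
    by (intro Inf_fin.coboundedI) (auto simp: P_def in_closures_if_mem)
  then have "m \<in> down_closure S"
    using assms(3) by (auto simp: down_closure_def)
  then have "sup (f S) m \<in> down_closure S"
    using Sup_fin_in_down_closure[of "{f S, m}" S] assms(2,4) by simp
  with up have "sup (f S) m \<in> S"
    using assms(2) mem_iff_closures by blast
  then show ?thesis
    by (simp add: upper_step_def Let_def P_def m_def)
qed

text \<open>Any constant could serve as the start, being monotone with finite range. Stage
  \<open>Suc n\<close> treats \<open>t n\<close>.\<close>

primrec approx :: "(nat \<Rightarrow> 'a::lattice) \<Rightarrow> nat \<Rightarrow> 'a set \<Rightarrow> 'a" where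
  "approx t 0 = (\<lambda>S. t 0)"
| "approx t (Suc n) = upper_step (t n) (lower_step (t n) (approx t n))"

lemma finite_range_approx: "finite (range (approx t n))"
  by (induction n) (simp_all add: finite_range_lower_step finite_range_upper_step)

lemma approx_mono: "bidom_le X Y \<Longrightarrow> approx t n X \<le> approx t n Y"
  by (induction n)
    (simp_all add: upper_step_mono lower_step_mono finite_range_approx finite_range_lower_step)

lemma approx_stable:
  assumes "approx t n S \<in> S" "n \<le> k"
  shows "approx t k S = approx t n S"
  using assms(2)
proof (induction k rule: dec_induct)
  case (step k)
  \<comment> \<open>This also puts the intermediate value in \<open>S\<close>, as
    \<open>upper_step_eq\<close> requires.\<close>
  have "lower_step (t k) (approx t k) S = approx t k S"
    using step assms(1) by (intro lower_step_eq finite_range_approx) simp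
  with step assms(1) show ?case
    by (simp add: upper_step_eq finite_range_lower_step finite_range_approx)
qed simp

lemma approx_mem:
  assumes "convex_sublattice S" "t n \<in> S"
  shows "approx t (Suc n) S \<in> S"
  using assms
  by (simp add: upper_step_mem lower_step_in_down_closure finite_range_lower_step
      finite_range_approx)

theorem mainTheorem6:
  assumes "countable (UNIV :: 'a::lattice set)"
  shows "CLSP TYPE('a)"
proof -
  \<comment> \<open>The enumeration may repeat elements, so finite lattices are covered too.\<close>
  obtain t :: "nat \<Rightarrow> 'a" where t: "range t = UNIV"
    using assms uncountable_def[of "UNIV :: 'a set"] by blast
  have ex: "\<exists>n. approx t n S \<in> S" if "S \<in> nonempty_convex_sublattices" for S
  proof -
    from that obtain s where "s \<in> S" and S: "convex_sublattice S"
      by (auto simp: nonempty_convex_sublattices_def)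
    moreover obtain n where "t n = s"
      using t by (metis rangeE UNIV_I)
    ultimately show ?thesis
      using approx_mem by blast
  qed
  define N where "N S = (LEAST n. approx t n S \<in> S)" for S
  have N: "approx t (N S) S \<in> S" if "S \<in> nonempty_convex_sublattices" for S
    unfolding N_def using ex[OF that] by (rule LeastI_ex)
  have "approx t (N X) X \<le> approx t (N Y) Y"
    if "X \<in> nonempty_convex_sublattices" "Y \<in> nonempty_convex_sublattices" "bidom_le X Y" for X Y
  proof -
    \<comment> \<open>\<open>N X\<close> and \<open>N Y\<close> may differ; at a common later stage
      both values are already final, and monotonicity of that single stage compares them.\<close>
    let ?k = "max (N X) (N Y)"
    have "approx t ?k X = approx t (N X) X" "approx t ?k Y = approx t (N Y) Y"
      using that N by (simp_all add: approx_stable)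
    with approx_mono[OF that(3), of t ?k] show ?thesis
      by simp
  qed
  with N show ?thesis
    unfolding CLSP_def by (intro exI[of _ "\<lambda>S. approx t (N S) S"]) (auto intro: monotone_onI)
qed

end
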